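(* Let $f:\mathbb{N}\to\mathbb{C}$ be an arithmetic function (where $\mathbb{N}=\{1,2,3,\dots\}$) and let $s\ge 1$ be real. Suppose that the series $\sum_{n=1}^{\infty}\frac{f(n)}{n^s}$ converges and the series $\sum_{n=1}^{\infty}\frac{f(n)}{n^{s-1}}$ diverges. Then $$\sum_{n\le x}\frac{f(n)}{n^{s-1}}=o(x),\qquad x\to\infty.$$
   Context: An arithmetic function is a function defined on the positive integers with complex values. Sums $\sum_{n\le x}$ run over positive integers $n\le x$. Convergence of a series means convergence of its partial sums to a finite limit (not necessarily absolute convergence). $A(x)=o(x)$ as $x\to\infty$ means $A(x)/x\to 0$. *)

theory Defs
  imports Complex_Main "HOL-Library.Landau_Symbols"
begin

end

(* The idea: this is Kronecker's lemma for the weights n, applied to a_n = f(n) / n^s.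
   Summation by parts writes the weighted partial sum, divided by N, as S_N minus the
   arithmetic mean of S_0, ..., S_{N-1}, where S_k are the partial sums of the convergent
   series; both terms tend to the sum of the series. *)
theory Submission
  imports Defs
begin

text \<open>Split the sum at an index \<open>M\<close> beyond which all terms have norm below
  \<open>e / 2\<close>. The tail then contributes at most \<open>e / 2\<close> to the mean, and the
  fixed head \<open>C\<close> is diluted by the division by \<open>N\<close>.\<close>

lemma cesaro_mean_null:
  fixes u :: "nat \<Rightarrow> 'a :: real_normed_vector"
  assumes "u \<longlonglongrightarrow> 0"
  shows "(\<lambda>N. (\<Sum>k<N. u k) /\<^sub>R real N) \<longlonglongrightarrow> 0"
proof (rule LIMSEQ_I)
  fix e :: real
  assume "e > 0"
  then obtain M where M: "\<And>k. k \<ge> M \<Longrightarrow> norm (u k) < e / 2"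
    using LIMSEQ_D[OF assms, of "e / 2"] by auto
  define C where "C = (\<Sum>k<M. norm (u k))"
  obtain K where K: "2 * C / e < real K"
    using reals_Archimedean2 by blast
  \<comment> \<open>The bound \<open>K\<close> forces \<open>C < N * e / 2\<close>;
    \<open>Suc M\<close> instead of \<open>M\<close> keeps \<open>N\<close> positive, so that the
    division by \<open>N\<close> can be cleared.\<close>
  have "norm ((\<Sum>k<N. u k) /\<^sub>R real N - 0) < e" if N: "N \<ge> max (Suc M) K" for N
  proof -
    have "norm (\<Sum>k<N. u k) \<le> (\<Sum>k<N. norm (u k))"
      by (rule norm_sum)
    also have "\<dots> = C + (\<Sum>k=M..<N. norm (u k))"
      using N sum.atLeastLessThan_concat[of 0 M N "\<lambda>k. norm (u k)"]
      by (simp add: C_def atLeast0LessThan)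
    also have "\<dots> \<le> C + (\<Sum>k=M..<N. e / 2)"
      using M by (intro add_left_mono sum_mono) (simp add: less_imp_le)
    also have "\<dots> \<le> C + real N * (e / 2)"
      using \<open>e > 0\<close> by (simp add: mult_right_mono)
    also have "\<dots> < real N * e"
    proof -
      have "2 * C / e < real N"
        using K N by linarith
      then show ?thesis
        using \<open>e > 0\<close> by (simp add: field_simps)
    qed
    finally show ?thesis
      using N by (simp add: field_simps)
  qed
  then show "\<exists>no. \<forall>N\<ge>no. norm ((\<Sum>k<N. u k) /\<^sub>R real N - 0) < e"
    by blast
qed

text \<open>The constant \<open>L\<close> is free because its contributions \<open>- N * L\<close>
  and \<open>+ N * L\<close> cancel. Choosing it as the sum of the series turns both terms on the
  right, after division by \<open>N\<close>, into null sequences.\<close>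

lemma summation_by_parts_Suc:
  fixes a :: "nat \<Rightarrow> 'a :: real_normed_vector" and L :: 'a
  shows "(\<Sum>k<N. real (Suc k) *\<^sub>R a k) =
    real N *\<^sub>R ((\<Sum>j<N. a j) - L) - (\<Sum>k<N. (\<Sum>j<k. a j) - L)"
  by (induction N) (simp_all add: algebra_simps)

lemma kronecker_lemma_Suc:
  fixes a :: "nat \<Rightarrow> 'a :: real_normed_vector"
  assumes "summable a"
  shows "(\<lambda>N. (\<Sum>k<N. real (Suc k) *\<^sub>R a k) /\<^sub>R real N) \<longlonglongrightarrow> 0"
proof -
  define u where "u N = (\<Sum>j<N. a j) - suminf a" for N
  have u: "u \<longlonglongrightarrow> 0"
    unfolding u_def using summable_LIMSEQ[OF assms] by (rule LIM_zero)
  have "(\<lambda>N. u N - (\<Sum>k<N. u k) /\<^sub>R real N) \<longlonglongrightarrow> 0"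
    using tendsto_diff[OF u cesaro_mean_null[OF u]] by simp
  \<comment> \<open>Only eventually: at \<open>N = 0\<close> the right side is 0 since
    \<open>inverse 0 = 0\<close>, while the left side is \<open>u 0 = - suminf a\<close>.\<close>
  moreover have "\<forall>\<^sub>F N in sequentially.
      u N - (\<Sum>k<N. u k) /\<^sub>R real N = (\<Sum>k<N. real (Suc k) *\<^sub>R a k) /\<^sub>R real N"
    using eventually_gt_at_top[of 0]
    by eventually_elim
      (simp only: summation_by_parts_Suc[where L = "suminf a"] u_def[symmetric],
       simp add: scaleR_diff_right)
  ultimately show ?thesis
    by (rule Lim_transform_eventually)
qed

theorem mainTheorem6:
  fixes f :: "nat \<Rightarrow> complex" and s :: real
  assumes "s \<ge> 1"
    and "summable (\<lambda>n. f (Suc n) / complex_of_real (real (Suc n) powr s))"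
    and "\<not> summable (\<lambda>n. f (Suc n) / complex_of_real (real (Suc n) powr (s - 1)))"
  shows "(\<lambda>x::real. \<Sum>n\<in>{n::nat. 1 \<le> n \<and> real n \<le> x}.
            f n / complex_of_real (real n powr (s - 1))) \<in> o[at_top](\<lambda>x. complex_of_real x)"
proof (rule landau_o.smallI)
  define g where "g n = f n / complex_of_real (real n powr (s - 1))" for n
  \<comment> \<open>Lowering the exponent from \<open>s\<close> to \<open>s - 1\<close> amounts to
    the weight \<open>Suc k\<close>, the one in Kronecker's lemma.\<close>
  have g: "g (Suc k) = real (Suc k) *\<^sub>R (f (Suc k) / complex_of_real (real (Suc k) powr s))" for k
    by (simp add: g_def powr_diff scaleR_conv_of_real)
  have lim: "(\<lambda>N. (\<Sum>k<N. g (Suc k)) /\<^sub>R real N) \<longlonglongrightarrow> 0"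
    unfolding g using assms(2) by (rule kronecker_lemma_Suc)
  fix c :: real
  assume "c > 0"
  then obtain M where M: "\<And>N. N \<ge> M \<Longrightarrow> norm ((\<Sum>k<N. g (Suc k)) /\<^sub>R real N) < c"
    using LIMSEQ_D[OF lim] by auto
  \<comment> \<open>The limit runs over integers \<open>N\<close>; real \<open>x\<close> is handled
    through its floor, as the sum depends only on \<open>N\<close> and \<open>c * N\<close> is at
    most \<open>c * x\<close>. Starting at \<open>Suc M\<close> ensures
    \<open>N > 0\<close>.\<close>
  have "norm (\<Sum>n\<in>{n. 1 \<le> n \<and> real n \<le> x}. g n) \<le> c * norm (complex_of_real x)"
    if x: "x \<ge> real (Suc M)" for x
  proof -
    define N where "N = nat \<lfloor>x\<rfloor>"
    have N: "N \<ge> Suc M" "real N \<le> x"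
      using x unfolding N_def by (simp_all add: le_nat_floor)
    have "{n. 1 \<le> n \<and> real n \<le> x} = Suc ` {..<N}"
      unfolding N_def image_Suc_lessThan using x by (auto simp: le_nat_iff le_floor_iff)
    then have "norm (\<Sum>n\<in>{n. 1 \<le> n \<and> real n \<le> x}. g n) = norm (\<Sum>k<N. g (Suc k))"
      by (simp add: sum.reindex)
    also have "\<dots> \<le> c * real N"
      using M[of N] N by (simp add: field_simps)
    also have "\<dots> \<le> c * norm (complex_of_real x)"
      using N \<open>c > 0\<close> by simp
    finally show ?thesis .
  qed
  then show "\<forall>\<^sub>F x in at_top. norm (\<Sum>n\<in>{n. 1 \<le> n \<and> real n \<le> x}.
      f n / complex_of_real (real n powr (s - 1))) \<le> c * norm (complex_of_real x)"
    unfolding g_def by (rule eventually_at_top_linorderI)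
qed

end
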